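(* Let $R$ be a ring, let $M$ be an $AB5^*$ right $R$-module and let $\alpha$ be an ordinal number. The following statements are equivalent. (1) $M$ is an $\alpha$-short module. (2) $M$ has a submodule $A$ such that $n\text{-}\dim(M/A)\le\alpha$ and $n\text{-}\dim N\le\alpha$ for every submodule $N$ of $M$ with $N\nsupseteq A$, and $\alpha$ is the least ordinal with this property (i.e. the least ordinal for which such a submodule $A$ exists).
   Context: Rings are associative with identity and modules are unital right modules. Ordinals are taken to begin with $-1$ (so $0$ is the successor of $-1$). Noetherian dimension (also called dual Krull dimension) $n\text{-}\dim M$: defined by transfinite recursion. $n\text{-}\dim M=-1$ iff $M=0$. For an ordinal $\alpha\ge 0$, $n\text{-}\dim M=\alpha$ iff $n\text{-}\dim M\not<\alpha$ and for every ascending chain $M_0\subseteq M_1\subseteq M_2\subseteq\cdots$ of submodules of $M$ there is $k$ with $n\text{-}\dim(M_{i+1}/M_i)<\alpha$ for all $i\ge k$. If no such ordinal exists, $M$ does not have Noetherian dimension. A statement such as $n\text{-}\dim X\le\alpha$ includes the assertion that $X$ has Noetherian dimension. A module $M$ is an $AB5^*$ module if for every submodule $B$ of $M$ and every inverse system (i.e. downward directed family) $\{A_i\}_{i\in I}$ of submodules of $M$, $B+\bigcap_{i\in I}A_i=\bigcap_{i\in I}(B+A_i)$. A module $M$ is $\alpha$-short if for every submodule $N$ of $M$ either $n\text{-}\dim N\le\alpha$ or $n\text{-}\dim(M/N)\le\alpha$, and $\alpha$ is the least ordinal with this property. *)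

theory Defs
  imports "HOL-Algebra.Module" "HOL-Algebra.AbelCoset"
begin

section \<open>Right modules\<close>

text \<open>
  The record \<^type>\<open>module_ext\<close> and the predicate \<^const>\<open>submodule\<close> of \<^theory>\<open>HOL-Algebra.Module\<close>
  are reused, but the library locale \<^locale>\<open>module\<close> demands a commutative ring.  Here the ring is
  arbitrary and \<open>a \<odot> x\<close> denotes the right action \<open>x \<cdot> a\<close>; hence the order of the factors in
  \<open>smult_assoc\<close>, which reads \<open>x \<cdot> (a b) = (x \<cdot> a) \<cdot> b\<close>.  The \<^const>\<open>mult\<close> and \<^const>\<open>one\<close> fields of a
  module record carry no meaning.
\<close>

locale right_module = R?: ring R + M?: abelian_group M
  for R :: "('r, 'z) ring_scheme" (structure) and M :: "('r, 'm, 'y) module_scheme" (structure) +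
  assumes smult_closed:
      "\<lbrakk>a \<in> carrier R; x \<in> carrier M\<rbrakk> \<Longrightarrow> a \<odot>\<^bsub>M\<^esub> x \<in> carrier M"
    and smult_l_distr:
      "\<lbrakk>a \<in> carrier R; b \<in> carrier R; x \<in> carrier M\<rbrakk> \<Longrightarrow>
        (a \<oplus>\<^bsub>R\<^esub> b) \<odot>\<^bsub>M\<^esub> x = a \<odot>\<^bsub>M\<^esub> x \<oplus>\<^bsub>M\<^esub> b \<odot>\<^bsub>M\<^esub> x"
    and smult_r_distr:
      "\<lbrakk>a \<in> carrier R; x \<in> carrier M; y \<in> carrier M\<rbrakk> \<Longrightarrow>
        a \<odot>\<^bsub>M\<^esub> (x \<oplus>\<^bsub>M\<^esub> y) = a \<odot>\<^bsub>M\<^esub> x \<oplus>\<^bsub>M\<^esub> a \<odot>\<^bsub>M\<^esub> y"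
    and smult_assoc:
      "\<lbrakk>a \<in> carrier R; b \<in> carrier R; x \<in> carrier M\<rbrakk> \<Longrightarrow>
        (a \<otimes>\<^bsub>R\<^esub> b) \<odot>\<^bsub>M\<^esub> x = b \<odot>\<^bsub>M\<^esub> (a \<odot>\<^bsub>M\<^esub> x)"
    and smult_one:
      "x \<in> carrier M \<Longrightarrow> \<one>\<^bsub>R\<^esub> \<odot>\<^bsub>M\<^esub> x = x"

definition quotient_module :: "('r, 'm) module \<Rightarrow> 'm set \<Rightarrow> ('r, 'm set) module" where
  "quotient_module M N =
    \<lparr>carrier = a_rcosets\<^bsub>M\<^esub> N, mult = undefined, one = undefined,
     zero = N, add = set_add M,
     smult = (\<lambda>a X. \<Union>x\<in>X. N +>\<^bsub>M\<^esub> (a \<odot>\<^bsub>M\<^esub> x))\<rparr>"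

text \<open>
  The isomorphic copy of \<open>M\<close> obtained by renaming its elements along \<open>f\<close>, which is meant to be
  injective on \<^term>\<open>carrier M\<close>.
\<close>

definition rename_module :: "('m \<Rightarrow> 'n) \<Rightarrow> ('r, 'm) module \<Rightarrow> ('r, 'n) module" where
  "rename_module f M =
    (let g = inv_into (carrier M) f in
     \<lparr>carrier = f ` carrier M, mult = undefined, one = undefined,
      zero = f \<zero>\<^bsub>M\<^esub>,
      add = (\<lambda>x y. f (g x \<oplus>\<^bsub>M\<^esub> g y)),
      smult = (\<lambda>a x. f (a \<odot>\<^bsub>M\<^esub> g x))\<rparr>)"

section \<open>Noetherian dimension\<close>

text \<open>
  Ordinals are represented by the elements of an arbitrary type of class
  \<open>{wellorder, order_bot}\<close>, with \<^term>\<open>bot\<close> in the role of \<open>-1\<close>.  Such a type is an initial segment of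
  the ordinals, and every condition below on an ordinal \<open>\<alpha>\<close> refers only to ordinals up to \<open>\<alpha>\<close>, so that
  it does not depend on the type in which \<open>\<alpha>\<close> is represented.

  \<open>has_ndim R \<alpha> M\<close> means that \<open>M\<close> has Noetherian dimension \<open>\<alpha>\<close>.  The elements of \<open>C (i+1) / C i\<close> are
  cosets.  As the recursion cannot change the type of the elements, every coset is renamed to a chosen
  element of it; distinct cosets are disjoint, so this renaming is injective.
\<close>

function has_ndim ::
  "('r, 'z) ring_scheme \<Rightarrow> 'o::{wellorder, order_bot} \<Rightarrow> ('r, 'm) module \<Rightarrow> bool" where
  "has_ndim R \<alpha> M \<longleftrightarrow>
    (if \<alpha> = bot then carrier M = {\<zero>\<^bsub>M\<^esub>}
     else \<not> (\<exists>\<beta>\<in>{..<\<alpha>}. has_ndim R \<beta> M) \<and>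
       (\<forall>C :: nat \<Rightarrow> 'm set.
         (\<forall>i. submodule (C i) R M) \<and> (\<forall>i. C i \<subseteq> C (Suc i)) \<longrightarrow>
         (\<exists>k. \<forall>i\<ge>k. \<exists>\<beta>\<in>{..<\<alpha>}.
           has_ndim R \<beta>
             (rename_module (\<lambda>X. SOME x. x \<in> X)
               (quotient_module (M\<lparr>carrier := C (Suc i)\<rparr>) (C i))))))"
  by pat_completeness auto
termination
  by (relation "inv_image {(\<beta>, \<alpha>). \<beta> < \<alpha>} (\<lambda>(R, \<alpha>, M). \<alpha>)") (auto simp: wf)

declare has_ndim.simps [simp del]

definition ndim_le ::
  "('r, 'z) ring_scheme \<Rightarrow> ('r, 'm) module \<Rightarrow> 'o::{wellorder, order_bot} \<Rightarrow> bool" where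
  "ndim_le R M \<alpha> \<longleftrightarrow> (\<exists>\<beta>\<le>\<alpha>. has_ndim R \<beta> M)"

section \<open>AB5* modules and alpha-short modules\<close>

text \<open>
  Only the set of members of an inverse system matters for the AB5* condition, so systems are given
  as nonempty downward directed sets of submodules instead of indexed families.
\<close>

definition AB5_star :: "('r, 'z) ring_scheme \<Rightarrow> ('r, 'm) module \<Rightarrow> bool" where
  "AB5_star R M \<longleftrightarrow>
    (\<forall>B \<A>. submodule B R M \<and> \<A> \<noteq> {} \<and> (\<forall>A\<in>\<A>. submodule A R M) \<and>
      (\<forall>A\<in>\<A>. \<forall>A'\<in>\<A>. \<exists>A''\<in>\<A>. A'' \<subseteq> A \<and> A'' \<subseteq> A') \<longrightarrow>
      B <+>\<^bsub>M\<^esub> (\<Inter>A\<in>\<A>. A) = (\<Inter>A\<in>\<A>. B <+>\<^bsub>M\<^esub> A))"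

definition least_ordinal_such_that :: "('o::wellorder \<Rightarrow> bool) \<Rightarrow> 'o \<Rightarrow> bool" where
  "least_ordinal_such_that P \<alpha> \<longleftrightarrow> P \<alpha> \<and> (\<forall>\<beta><\<alpha>. \<not> P \<beta>)"

definition short_module ::
  "('r, 'z) ring_scheme \<Rightarrow> ('r, 'm) module \<Rightarrow> 'o::{wellorder, order_bot} \<Rightarrow> bool" where
  "short_module R M \<alpha> \<longleftrightarrow>
    least_ordinal_such_that
      (\<lambda>\<beta>. \<forall>N. submodule N R M \<longrightarrow>
        ndim_le R (M\<lparr>carrier := N\<rparr>) \<beta> \<or> ndim_le R (quotient_module M N) \<beta>) \<alpha>"

end

theory Submission
  imports Defs "HOL-Library.Nat_Bijection"
begin

text \<open>
  Call a submodule \<open>N\<close> small if \<open>n-dim N \<le> \<beta>\<close> and cosmall if \<open>n-dim (M/N) \<le> \<beta>\<close>.  The two properties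
  of \<open>\<beta>\<close> whose least witnesses are compared turn out to be equivalent for every single \<open>\<beta>\<close>.
  Given \<open>A\<close> as in the second one, a submodule containing \<open>A\<close> is cosmall, because \<open>M/N\<close> is then a
  quotient of \<open>M/A\<close>, and every other submodule is small.  Conversely, if every submodule is small or
  cosmall, let \<open>A\<close> be the intersection of all cosmall submodules.  A submodule that does not contain
  \<open>A\<close> is not cosmall, hence small, and what remains is that \<open>A\<close> itself is cosmall.

  This is where AB5* enters.  Cosmall submodules are closed under binary intersection
  (\<open>dev_le_Int\<close>), so they form an inverse system.  If \<open>A\<close> were not cosmall, there would be an
  ascending chain \<open>C\<close> above \<open>A\<close> with infinitely many big factors, that is, factors of dimension not
  below \<open>\<beta>\<close>.  For a cosmall \<open>D\<close> the factors of the chain \<open>C i + D\<close> are eventually not big, hence at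
  some late big step \<open>D\<close> meets \<open>C (i+1)\<close> in an element \<open>x\<close> outside \<open>C i\<close>.  By AB5*, \<open>C i = C i + A\<close> is
  the intersection of all \<open>C i + D'\<close> with \<open>D'\<close> cosmall, so that some \<open>D' \<subseteq> D\<close> satisfies
  \<open>x \<notin> C i + D'\<close>.  Repeating the argument with \<open>D'\<close> and a later step produces elements \<open>x k\<close> and
  submodules \<open>E k\<close>, the sums \<open>C i + D'\<close> met on the way, such that \<open>x k\<close> lies in all of the submodules
  \<open>E l\<close> except for \<open>E k\<close>.  The intersections of the \<open>E k\<close> then form a copy of the power set of the
  natural numbers inside the lattice of submodules, and a lattice interval that contains such a copy
  has no Noetherian dimension (\<open>no_dev_le_powerset\<close>).  Halving the index set gives a submodule \<open>N\<close> for
  which both \<open>N\<close> and \<open>M/N\<close> contain such a copy, so that \<open>N\<close> is neither small nor cosmall: a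
  contradiction (\<open>not_short_if_independent\<close>, \<open>dev_le_Inter_if_short\<close>).

  Noetherian dimension is an invariant of the lattice of submodules, and the argument is carried out
  there: \<open>n-dim (B/A) \<le> \<gamma>\<close> is replaced by a condition \<open>dev_le\<close> on the interval from \<open>A\<close> to \<open>B\<close>, which
  makes sense in any ordered set.  The isomorphism theorems and exact sequences of modules are
  replaced by a single principle (\<open>dev_le_jointly_strict\<close>): the dimension cannot drop along strictly
  monotone maps.
\<close>

section \<open>Deviation of intervals in a partially ordered set\<close>

text \<open>
  The deviation of the part of \<open>L\<close> between \<open>a\<close> and \<open>b\<close>, for ascending chains.  If \<open>\<gamma>\<close> is the least
  ordinal, no chain satisfies the condition of the second rule, so that among nonempty intervals only
  those with a single point qualify; this is the dimension \<open>-1\<close> of the zero module.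
\<close>

inductive dev_le :: "'a::order set \<Rightarrow> 'o::wellorder \<Rightarrow> 'a \<Rightarrow> 'a \<Rightarrow> bool" for L where
  trivial: "dev_le L \<gamma> a a"
| chain: "(\<And>C :: nat \<Rightarrow> 'a. (\<And>i. C i \<in> L \<and> a \<le> C i \<and> C i \<le> b \<and> C i \<le> C (Suc i)) \<Longrightarrow>
      \<exists>k. \<forall>i\<ge>k. \<exists>\<delta><\<gamma>. dev_le L \<delta> (C i) (C (Suc i))) \<Longrightarrow> dev_le L \<gamma> a b"

text \<open>
  The existence of an ordinal below \<open>\<gamma>\<close> is what allows one-point intervals to be treated like the
  others: their chains are constant, and constant steps have every deviation.
\<close>

lemma dev_le_chain:
  assumes "dev_le L \<gamma> a b" "\<delta>' < \<gamma>"
    and "\<And>i. C i \<in> L \<and> a \<le> C i \<and> C i \<le> b" "\<And>i. C i \<le> C (Suc i)"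
  shows "\<exists>k. \<forall>i\<ge>k. \<exists>\<delta><\<gamma>. dev_le L \<delta> (C i) (C (Suc i))"
  using assms(1)
proof cases
  case trivial
  then have "C i = a" for i
    using assms(3)[of i] by auto
  then show ?thesis
    using assms(2) dev_le.trivial by metis
next
  case chain
  then show ?thesis using assms(3,4) by blast
qed

lemma dev_le_exists_less:
  assumes "dev_le L \<gamma> a b" "a \<noteq> b" "c \<in> L" "a \<le> c" "c \<le> b"
  shows "\<exists>\<delta>. \<delta> < \<gamma>"
  using assms(1)
proof cases
  case trivial
  then show ?thesis using assms(2) by simp
next
  case chain
  from chain[of "\<lambda>_. c"] show ?thesis using assms by auto
qed

lemma dev_le_mono:
  assumes "dev_le L \<gamma> a b" "\<gamma> \<le> \<gamma>'"
  shows "dev_le L \<gamma>' a b"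
  using assms(1)
proof cases
  case trivial
  then show ?thesis by (simp add: dev_le.trivial)
next
  case chain
  show ?thesis
    proof (rule dev_le.chain)
    fix C :: "nat \<Rightarrow> 'a"
    assume "\<And>i. C i \<in> L \<and> a \<le> C i \<and> C i \<le> b \<and> C i \<le> C (Suc i)"
    then obtain k where "\<forall>i\<ge>k. \<exists>\<delta><\<gamma>. dev_le L \<delta> (C i) (C (Suc i))"
      using chain by blast
    then show "\<exists>k. \<forall>i\<ge>k. \<exists>\<delta><\<gamma>'. dev_le L \<delta> (C i) (C (Suc i))"
      using assms(2) order.strict_trans2 by blast
  qed
qed

text \<open>
  Two monotone maps that together separate comparable elements suffice to bound the deviation of
  their common domain: a chain is carried to two chains, each of whose steps eventually has deviation
  below \<open>\<gamma>\<close>, and the same two maps, restricted to a step, show by induction that the step itself has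
  deviation at most the larger of the two.  In a modular lattice this yields the behaviour
  of dimension in extensions, the relevant pair being \<open>x \<mapsto> x \<inter> n\<close> and \<open>x \<mapsto> x + n\<close>.
\<close>

lemma dev_le_jointly_strict:
  fixes \<gamma> :: "'o::wellorder" and g :: "'a::order \<Rightarrow> 'b::order" and h :: "'a \<Rightarrow> 'c::order"
  assumes "dev_le L1 \<gamma> a1 b1" "dev_le L2 \<gamma> a2 b2" "a \<le> b" "a \<in> L" "b \<in> L"
    and "\<And>x. \<lbrakk>x \<in> L; a \<le> x; x \<le> b\<rbrakk> \<Longrightarrow> g x \<in> L1 \<and> a1 \<le> g x \<and> g x \<le> b1"
    and "\<And>x. \<lbrakk>x \<in> L; a \<le> x; x \<le> b\<rbrakk> \<Longrightarrow> h x \<in> L2 \<and> a2 \<le> h x \<and> h x \<le> b2"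
    and "\<And>x y. \<lbrakk>x \<in> L; y \<in> L; a \<le> x; x \<le> y; y \<le> b\<rbrakk> \<Longrightarrow> g x \<le> g y"
    and "\<And>x y. \<lbrakk>x \<in> L; y \<in> L; a \<le> x; x \<le> y; y \<le> b\<rbrakk> \<Longrightarrow> h x \<le> h y"
    and "\<And>x y. \<lbrakk>x \<in> L; y \<in> L; a \<le> x; x \<le> y; y \<le> b; g x = g y; h x = h y\<rbrakk> \<Longrightarrow> x = y"
  shows "dev_le L \<gamma> a b"
  using assms
proof (induction \<gamma> arbitrary: a b a1 b1 a2 b2 rule: less_induct)
  case (less \<gamma>)
  note img1 = less.prems(6) and img2 = less.prems(7) and mono1 = less.prems(8)
    and mono2 = less.prems(9) and strict = less.prems(10)
  show ?case
  proof (cases "\<exists>\<delta>. \<delta> < \<gamma>")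
    case False
    have "a1 = b1" "a2 = b2"
      using False dev_le_exists_less[OF less.prems(1), of "g a"] img1[of a]
        dev_le_exists_less[OF less.prems(2), of "h a"] img2[of a] less.prems(3,4)
      by blast+
    then have "g a = g b" "h a = h b"
      using img1[of a] img1[of b] img2[of a] img2[of b] less.prems(3-5) by force+
    then have "a = b" using strict less.prems(3-5) by blast
    then show ?thesis by (simp add: dev_le.trivial)
  next
    case True
    then obtain \<delta>' where d': "\<delta>' < \<gamma>" by blast
    show ?thesis
    proof (rule dev_le.chain)
      fix C :: "nat \<Rightarrow> 'a"
      assume "\<And>i. C i \<in> L \<and> a \<le> C i \<and> C i \<le> b \<and> C i \<le> C (Suc i)"
      then have C: "C i \<in> L" "a \<le> C i" "C i \<le> b" "C i \<le> C (Suc i)" for i by auto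
      obtain k1 where k1: "\<And>i. i \<ge> k1 \<Longrightarrow> \<exists>\<delta><\<gamma>. dev_le L1 \<delta> (g (C i)) (g (C (Suc i)))"
        using dev_le_chain[OF less.prems(1) d', of "\<lambda>i. g (C i)"] img1 mono1 C by blast
      obtain k2 where k2: "\<And>i. i \<ge> k2 \<Longrightarrow> \<exists>\<delta><\<gamma>. dev_le L2 \<delta> (h (C i)) (h (C (Suc i)))"
        using dev_le_chain[OF less.prems(2) d', of "\<lambda>i. h (C i)"] img2 mono2 C by blast
      have "\<exists>\<delta><\<gamma>. dev_le L \<delta> (C i) (C (Suc i))" if i: "i \<ge> max k1 k2" for i
      proof -
        obtain \<delta>1 \<delta>2 where d1: "\<delta>1 < \<gamma>" "dev_le L1 \<delta>1 (g (C i)) (g (C (Suc i)))"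
          and d2: "\<delta>2 < \<gamma>" "dev_le L2 \<delta>2 (h (C i)) (h (C (Suc i)))"
          using k1[of i] k2[of i] i by auto
        have inI: "a \<le> x" "x \<le> b" if "C i \<le> x" "x \<le> C (Suc i)" for x
          using that C order_trans by blast+
        have less_max: "max \<delta>1 \<delta>2 < \<gamma>" using d1 d2 by simp
        have g_max: "dev_le L1 (max \<delta>1 \<delta>2) (g (C i)) (g (C (Suc i)))"
          using d1(2) by (rule dev_le_mono) simp
        have h_max: "dev_le L2 (max \<delta>1 \<delta>2) (h (C i)) (h (C (Suc i)))"
          using d2(2) by (rule dev_le_mono) simp
        have "dev_le L (max \<delta>1 \<delta>2) (C i) (C (Suc i))"
        proof (rule less.IH[OF less_max g_max h_max])
          show "C i \<le> C (Suc i)" "C i \<in> L" "C (Suc i) \<in> L" using C by blast+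
        next
          fix x assume x: "x \<in> L" "C i \<le> x" "x \<le> C (Suc i)"
          then have x': "a \<le> x" "x \<le> b" using inI by blast+
          show "g x \<in> L1 \<and> g (C i) \<le> g x \<and> g x \<le> g (C (Suc i))"
            using img1[OF x(1) x'] mono1[OF C(1) x(1) C(2) x(2) x'(2)]
              mono1[OF x(1) C(1) x'(1) x(3) C(3)] by blast
          show "h x \<in> L2 \<and> h (C i) \<le> h x \<and> h x \<le> h (C (Suc i))"
            using img2[OF x(1) x'] mono2[OF C(1) x(1) C(2) x(2) x'(2)]
              mono2[OF x(1) C(1) x'(1) x(3) C(3)] by blast
        next
          fix x y assume xy: "x \<in> L" "y \<in> L" "C i \<le> x" "x \<le> y" "y \<le> C (Suc i)"
          have ab: "a \<le> x" "y \<le> b" using xy(3,5) C(2,3) order_trans by blast+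
          show "g x \<le> g y" "h x \<le> h y"
            using mono1[OF xy(1,2) ab(1) xy(4) ab(2)] mono2[OF xy(1,2) ab(1) xy(4) ab(2)] by simp_all
          show "x = y" if "g x = g y" "h x = h y"
            using strict[OF xy(1,2) ab(1) xy(4) ab(2) that] .
        qed
        then show ?thesis using less_max by blast
      qed
      then show "\<exists>k. \<forall>i\<ge>k. \<exists>\<delta><\<gamma>. dev_le L \<delta> (C i) (C (Suc i))" by blast
    qed
  qed
qed

lemma dev_le_strict:
  fixes \<gamma> :: "'o::wellorder" and g :: "'a::order \<Rightarrow> 'b::order"
  assumes "dev_le L' \<gamma> a' b'" "a \<le> b" "a \<in> L" "b \<in> L"
    and "\<And>x. \<lbrakk>x \<in> L; a \<le> x; x \<le> b\<rbrakk> \<Longrightarrow> g x \<in> L' \<and> a' \<le> g x \<and> g x \<le> b'"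
    and "\<And>x y. \<lbrakk>x \<in> L; y \<in> L; a \<le> x; x \<le> y; y \<le> b\<rbrakk> \<Longrightarrow> g x \<le> g y"
    and "\<And>x y. \<lbrakk>x \<in> L; y \<in> L; a \<le> x; x \<le> y; y \<le> b; g x = g y\<rbrakk> \<Longrightarrow> x = y"
  shows "dev_le L \<gamma> a b"
  by (rule dev_le_jointly_strict[OF assms(1) assms(1) assms(2-4) assms(5) assms(5) assms(6) assms(6) assms(7)])

lemma dev_le_subinterval:
  assumes "dev_le L \<gamma> a b" "a \<le> a'" "a' \<le> b'" "b' \<le> b" "a' \<in> L" "b' \<in> L"
  shows "dev_le L \<gamma> a' b'"
  by (rule dev_le_strict[OF assms(1) assms(3) assms(5,6), where g = "\<lambda>x. x"])
    (use assms(2,4) in \<open>auto intro: order_trans\<close>)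

text \<open>
  Splitting the natural numbers into infinitely many infinite blocks and adding one block after
  the other gives an ascending chain all of whose steps contain a copy of the whole power set again.
  By induction, none of these steps has a deviation below \<open>\<gamma>\<close>.
\<close>

lemma no_dev_le_powerset:
  fixes F :: "nat set \<Rightarrow> 'a::order"
  assumes "\<And>S. F S \<in> L \<and> a \<le> F S \<and> F S \<le> b" "\<And>S S'. S \<subset> S' \<Longrightarrow> F S < F S'"
  shows "\<not> dev_le L \<gamma> a b"
  using assms
proof (induction \<gamma> arbitrary: F a b rule: less_induct)
  case (less \<gamma>)
  note F = less.prems(1) and strict = less.prems(2)
  have mono: "F S \<le> F S'" if "S \<subseteq> S'" for S S'
    using strict[of S S'] that by (cases "S = S'") (simp_all add: psubset_eq)
  define E :: "nat \<Rightarrow> nat set" where "E i = prod_encode ` ({..<i} \<times> UNIV)" for i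
  show ?case
  proof
    assume "dev_le L \<gamma> a b"
    then show False
    proof cases
      case trivial
      then have "F {} = F UNIV" using F by (metis order.antisym)
      then show False using strict[of "{}" UNIV] by (simp add: psubset_eq)
    next
      case chain
      have "F (E i) \<le> F (E (Suc i))" for i
        unfolding E_def by (intro mono image_mono) auto
      then have "\<exists>k. \<forall>i\<ge>k. \<exists>\<delta><\<gamma>. dev_le L \<delta> (F (E i)) (F (E (Suc i)))"
        using F by (intro chain) simp
      then obtain i \<delta> where d: "\<delta> < \<gamma>" "dev_le L \<delta> (F (E i)) (F (E (Suc i)))"
        by blast
      (* F between E i and E (Suc i), transported along the bijection of the naturals with block i *)
      define G where "G S = F (E i \<union> prod_encode ` ({i} \<times> S))" for S
      have "\<not> dev_le L \<delta> (F (E i)) (F (E (Suc i)))"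
      proof (rule less.IH[OF d(1), of G])
        fix S :: "nat set"
        have "F (E i) \<le> G S" unfolding G_def by (intro mono) simp
        moreover have "G S \<le> F (E (Suc i))"
          unfolding G_def E_def by (intro mono) (auto simp del: prod_encode_eq)
        ultimately show "G S \<in> L \<and> F (E i) \<le> G S \<and> G S \<le> F (E (Suc i))"
          using F by (simp add: G_def)
      next
        fix S S' :: "nat set"
        assume "S \<subset> S'"
        then obtain n where n: "n \<in> S'" "n \<notin> S" "S \<subseteq> S'" by blast
        then have "prod_encode (i, n) \<notin> E i \<union> prod_encode ` ({i} \<times> S)"
          by (auto simp: E_def)
        with n have "E i \<union> prod_encode ` ({i} \<times> S) \<subset> E i \<union> prod_encode ` ({i} \<times> S')"
          by blast
        then show "G S < G S'" unfolding G_def by (rule strict)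
      qed
      with d(2) show False by simp
    qed
  qed
qed

section \<open>The lattice of submodules\<close>

context right_module
begin

abbreviation submods :: "'m set set" where "submods \<equiv> {N. submodule N R M}"

lemma smult_zero_left:
  assumes x: "x \<in> carrier M"
  shows "\<zero>\<^bsub>R\<^esub> \<odot>\<^bsub>M\<^esub> x = \<zero>\<^bsub>M\<^esub>"
proof -
  have c: "\<zero>\<^bsub>R\<^esub> \<odot>\<^bsub>M\<^esub> x \<in> carrier M" using x by (simp add: smult_closed)
  have "\<zero>\<^bsub>R\<^esub> \<odot>\<^bsub>M\<^esub> x \<oplus>\<^bsub>M\<^esub> \<zero>\<^bsub>R\<^esub> \<odot>\<^bsub>M\<^esub> x = \<zero>\<^bsub>R\<^esub> \<odot>\<^bsub>M\<^esub> x"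
    using smult_l_distr[of "\<zero>\<^bsub>R\<^esub>" "\<zero>\<^bsub>R\<^esub>" x] x by simp
  then show ?thesis using M.add.l_cancel_one[OF c c] by simp
qed

lemma smult_zero_right:
  assumes a: "a \<in> carrier R"
  shows "a \<odot>\<^bsub>M\<^esub> \<zero>\<^bsub>M\<^esub> = \<zero>\<^bsub>M\<^esub>"
proof -
  have c: "a \<odot>\<^bsub>M\<^esub> \<zero>\<^bsub>M\<^esub> \<in> carrier M" using a by (simp add: smult_closed)
  have "a \<odot>\<^bsub>M\<^esub> \<zero>\<^bsub>M\<^esub> \<oplus>\<^bsub>M\<^esub> a \<odot>\<^bsub>M\<^esub> \<zero>\<^bsub>M\<^esub> = a \<odot>\<^bsub>M\<^esub> \<zero>\<^bsub>M\<^esub>"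
    using smult_r_distr[of a "\<zero>\<^bsub>M\<^esub>" "\<zero>\<^bsub>M\<^esub>"] a by simp
  then show ?thesis using M.add.l_cancel_one[OF c c] by simp
qed

lemma minus_eq_smult:
  assumes "x \<in> carrier M"
  shows "\<ominus>\<^bsub>M\<^esub> x = (\<ominus>\<^bsub>R\<^esub> \<one>\<^bsub>R\<^esub>) \<odot>\<^bsub>M\<^esub> x"
proof -
  have "(\<ominus>\<^bsub>R\<^esub> \<one>\<^bsub>R\<^esub>) \<odot>\<^bsub>M\<^esub> x \<oplus>\<^bsub>M\<^esub> x = (\<ominus>\<^bsub>R\<^esub> \<one>\<^bsub>R\<^esub> \<oplus>\<^bsub>R\<^esub> \<one>\<^bsub>R\<^esub>) \<odot>\<^bsub>M\<^esub> x"
    using assms by (subst smult_l_distr) (simp_all add: smult_one)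
  also have "\<dots> = \<zero>\<^bsub>M\<^esub>" using assms by (simp add: R.l_neg smult_zero_left)
  finally show ?thesis
    using assms by (intro M.minus_equality) (auto simp: smult_closed)
qed

text \<open>
  Closure under negation is automatic, since \<open>-x = x \<cdot> (-1)\<close>.
\<close>

lemma submodule_iff:
  "submodule N R M \<longleftrightarrow> N \<subseteq> carrier M \<and> \<zero>\<^bsub>M\<^esub> \<in> N \<and> (\<forall>x\<in>N. \<forall>y\<in>N. x \<oplus>\<^bsub>M\<^esub> y \<in> N) \<and>
    (\<forall>a\<in>carrier R. \<forall>x\<in>N. a \<odot>\<^bsub>M\<^esub> x \<in> N)" (is "?l \<longleftrightarrow> ?r")
proof
  assume ?l
  then interpret submodule N R M .
  show ?r using subset one_closed m_closed smult_closed by auto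
next
  assume r: ?r
  have "\<ominus>\<^bsub>M\<^esub> x \<in> N" if "x \<in> N" for x
    using r that minus_eq_smult[of x] by (metis R.add.inv_closed R.one_closed subsetD)
  then have "subgroup N (add_monoid M)"
    using r by (intro subgroup.intro) (auto simp: a_inv_def)
  then show ?l using r by (auto intro!: submodule.intro submodule_axioms.intro)
qed

lemma submoduleD:
  assumes "submodule N R M"
  shows "N \<subseteq> carrier M" "\<zero>\<^bsub>M\<^esub> \<in> N" "\<And>x y. \<lbrakk>x \<in> N; y \<in> N\<rbrakk> \<Longrightarrow> x \<oplus>\<^bsub>M\<^esub> y \<in> N"
    "\<And>a x. \<lbrakk>a \<in> carrier R; x \<in> N\<rbrakk> \<Longrightarrow> a \<odot>\<^bsub>M\<^esub> x \<in> N" "\<And>x. x \<in> N \<Longrightarrow> \<ominus>\<^bsub>M\<^esub> x \<in> N"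
  using assms minus_eq_smult unfolding submodule_iff by (auto dest: subsetD)

lemma submodule_zero: "submodule {\<zero>\<^bsub>M\<^esub>} R M"
  by (auto simp: submodule_iff smult_zero_right)

lemma submodule_carrier: "submodule (carrier M) R M"
  by (auto simp: submodule_iff smult_closed)

lemma submodule_Inter:
  assumes "\<T> \<noteq> {}" "\<And>N. N \<in> \<T> \<Longrightarrow> submodule N R M"
  shows "submodule (\<Inter>\<T>) R M"
  using assms unfolding submodule_iff by blast

lemma submodule_Int:
  assumes "submodule N R M" "submodule K R M"
  shows "submodule (N \<inter> K) R M"
  using assms unfolding submodule_iff by blast

lemma mem_sum_iff: "z \<in> N <+>\<^bsub>M\<^esub> K \<longleftrightarrow> (\<exists>x\<in>N. \<exists>y\<in>K. z = x \<oplus>\<^bsub>M\<^esub> y)"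
  by (auto simp: set_add_def')

lemma submodule_sum:
  assumes "submodule N R M" "submodule K R M"
  shows "submodule (N <+>\<^bsub>M\<^esub> K) R M"
  unfolding submodule_iff
proof (intro conjI ballI)
  note n = submoduleD[OF assms(1)] and k = submoduleD[OF assms(2)]
  show "N <+>\<^bsub>M\<^esub> K \<subseteq> carrier M" using n(1) k(1) by (auto simp: mem_sum_iff subset_iff)
  show "\<zero>\<^bsub>M\<^esub> \<in> N <+>\<^bsub>M\<^esub> K" using n(2) k(2) by (force simp: mem_sum_iff)
  show "z \<oplus>\<^bsub>M\<^esub> z' \<in> N <+>\<^bsub>M\<^esub> K" if zz': "z \<in> N <+>\<^bsub>M\<^esub> K" "z' \<in> N <+>\<^bsub>M\<^esub> K" for z z'
  proof -
    from zz' obtain x y x' y' where "x \<in> N" "y \<in> K" "z = x \<oplus>\<^bsub>M\<^esub> y"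
      and "x' \<in> N" "y' \<in> K" "z' = x' \<oplus>\<^bsub>M\<^esub> y'"
      by (auto simp: mem_sum_iff)
    moreover from this have "z \<oplus>\<^bsub>M\<^esub> z' = (x \<oplus>\<^bsub>M\<^esub> x') \<oplus>\<^bsub>M\<^esub> (y \<oplus>\<^bsub>M\<^esub> y')"
      using n(1) k(1) by (simp add: M.a_ac subsetD)
    ultimately show ?thesis unfolding mem_sum_iff using n(3) k(3) by blast
  qed
  show "a \<odot>\<^bsub>M\<^esub> z \<in> N <+>\<^bsub>M\<^esub> K" if "a \<in> carrier R" "z \<in> N <+>\<^bsub>M\<^esub> K" for a z
  proof -
    from that obtain x y where xy: "x \<in> N" "y \<in> K" "z = x \<oplus>\<^bsub>M\<^esub> y"
      by (auto simp: mem_sum_iff)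
    then have "a \<odot>\<^bsub>M\<^esub> z = a \<odot>\<^bsub>M\<^esub> x \<oplus>\<^bsub>M\<^esub> a \<odot>\<^bsub>M\<^esub> y"
      using that(1) n(1) k(1) by (simp add: smult_r_distr subsetD)
    then show ?thesis unfolding mem_sum_iff using n(4) k(4) that(1) xy by blast
  qed
qed

lemma sum_upper:
  assumes "submodule N R M" "submodule K R M"
  shows "N \<subseteq> N <+>\<^bsub>M\<^esub> K" "K \<subseteq> N <+>\<^bsub>M\<^esub> K"
proof -
  note n = submoduleD[OF assms(1)] and k = submoduleD[OF assms(2)]
  show "N \<subseteq> N <+>\<^bsub>M\<^esub> K"
  proof
    fix x assume "x \<in> N"
    then show "x \<in> N <+>\<^bsub>M\<^esub> K"
      unfolding mem_sum_iff using n(1) k(2) by (intro bexI[of _ x] bexI[of _ "\<zero>\<^bsub>M\<^esub>"]) auto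
  qed
  show "K \<subseteq> N <+>\<^bsub>M\<^esub> K"
  proof
    fix x assume "x \<in> K"
    then show "x \<in> N <+>\<^bsub>M\<^esub> K"
      unfolding mem_sum_iff using n(2) k(1) by (intro bexI[of _ "\<zero>\<^bsub>M\<^esub>"] bexI[of _ x]) auto
  qed
qed

lemma sum_mono: "N \<subseteq> N' \<Longrightarrow> N <+>\<^bsub>M\<^esub> K \<subseteq> N' <+>\<^bsub>M\<^esub> K"
  unfolding subset_iff mem_sum_iff by blast

lemma sum_least: "\<lbrakk>submodule P R M; N \<subseteq> P; K \<subseteq> P\<rbrakk> \<Longrightarrow> N <+>\<^bsub>M\<^esub> K \<subseteq> P"
  using submoduleD(3)[of P] by (auto simp: mem_sum_iff subset_iff)

text \<open>
  The modular law: \<open>P \<mapsto> P + K\<close> is strictly monotone as long as the intersection with \<open>K\<close> stays the same.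
\<close>

lemma eq_if_sum_eq:
  assumes "submodule P R M" "submodule P' R M" "submodule K R M" "P \<subseteq> P'"
    and "P <+>\<^bsub>M\<^esub> K = P' <+>\<^bsub>M\<^esub> K" "P' \<inter> K \<subseteq> P"
  shows "P = P'"
proof
  show "P' \<subseteq> P"
  proof
    fix z assume z: "z \<in> P'"
    then obtain x y where xy: "x \<in> P" "y \<in> K" "z = x \<oplus>\<^bsub>M\<^esub> y"
      using assms(5) sum_upper(1)[OF assms(2,3)] by (metis mem_sum_iff subsetD)
    have c: "x \<in> carrier M" "y \<in> carrier M"
      using xy submoduleD(1)[OF assms(1)] submoduleD(1)[OF assms(3)] by auto
    then have "y = \<ominus>\<^bsub>M\<^esub> x \<oplus>\<^bsub>M\<^esub> z" by (simp add: xy(3) M.r_neg1)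
    moreover have "\<ominus>\<^bsub>M\<^esub> x \<oplus>\<^bsub>M\<^esub> z \<in> P'"
      using xy(1) z assms(4) submoduleD(3,5)[OF assms(2)] by auto
    ultimately have "y \<in> P" using xy(2) assms(6) by auto
    then show "z \<in> P" using xy submoduleD(3)[OF assms(1)] by simp
  qed
qed fact

section \<open>Noetherian dimension as deviation of the lattice of submodules\<close>

text \<open>
  \<open>X\<close> is a copy of the subquotient \<open>B/A\<close>: the map \<open>\<phi>\<close> is an epimorphism from \<open>B\<close> to \<open>X\<close> with kernel
  \<open>A\<close>.  The recursion that defines Noetherian dimension passes to quotients of submodules of
  quotients, renaming elements each time; with such an epimorphism all of these modules are measured
  inside the one module \<open>M\<close>.
\<close>

definition presents :: "('m \<Rightarrow> 'n) \<Rightarrow> ('r, 'n) module \<Rightarrow> 'm set \<Rightarrow> 'm set \<Rightarrow> bool" where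
  "presents \<phi> X A B \<longleftrightarrow>
    submodule A R M \<and> submodule B R M \<and> A \<subseteq> B \<and> carrier X = \<phi> ` B \<and> \<zero>\<^bsub>X\<^esub> = \<phi> \<zero>\<^bsub>M\<^esub> \<and>
    (\<forall>x\<in>B. \<forall>y\<in>B. \<phi> (x \<oplus>\<^bsub>M\<^esub> y) = \<phi> x \<oplus>\<^bsub>X\<^esub> \<phi> y) \<and>
    (\<forall>a\<in>carrier R. \<forall>x\<in>B. \<phi> (a \<odot>\<^bsub>M\<^esub> x) = a \<odot>\<^bsub>X\<^esub> \<phi> x) \<and>
    (\<forall>x\<in>B. \<phi> x = \<phi> \<zero>\<^bsub>M\<^esub> \<longleftrightarrow> x \<in> A)"

context
  fixes \<phi> :: "'m \<Rightarrow> 'n" and X A B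
  assumes pres: "presents \<phi> X A B"
begin

lemma presentsD:
  shows "submodule A R M" "submodule B R M" "A \<subseteq> B" "carrier X = \<phi> ` B" "\<zero>\<^bsub>X\<^esub> = \<phi> \<zero>\<^bsub>M\<^esub>"
    "\<And>x y. \<lbrakk>x \<in> B; y \<in> B\<rbrakk> \<Longrightarrow> \<phi> (x \<oplus>\<^bsub>M\<^esub> y) = \<phi> x \<oplus>\<^bsub>X\<^esub> \<phi> y"
    "\<And>a x. \<lbrakk>a \<in> carrier R; x \<in> B\<rbrakk> \<Longrightarrow> \<phi> (a \<odot>\<^bsub>M\<^esub> x) = a \<odot>\<^bsub>X\<^esub> \<phi> x"
    "\<And>x. x \<in> B \<Longrightarrow> \<phi> x = \<phi> \<zero>\<^bsub>M\<^esub> \<longleftrightarrow> x \<in> A"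
  using pres unfolding presents_def by simp_all

lemma presents_right_module: "right_module R X"
proof -
  note B = submoduleD[OF presentsD(2)] and hom = presentsD(6,7)[symmetric]
  have c: "x \<in> carrier M" if "x \<in> B" for x using that B(1) by auto
  have "abelian_group X"
  proof (rule abelian_groupI; (unfold presentsD(4,5))?)
    fix x y z
    assume "x \<in> \<phi> ` B" "y \<in> \<phi> ` B" "z \<in> \<phi> ` B"
    then show "x \<oplus>\<^bsub>X\<^esub> y \<oplus>\<^bsub>X\<^esub> z = x \<oplus>\<^bsub>X\<^esub> (y \<oplus>\<^bsub>X\<^esub> z)"
      by (auto simp: hom B M.a_assoc c)
  next
    fix x assume "x \<in> \<phi> ` B"
    then obtain u where u: "u \<in> B" "x = \<phi> u" by auto
    have "\<phi> (\<ominus>\<^bsub>M\<^esub> u) \<oplus>\<^bsub>X\<^esub> x = \<phi> \<zero>\<^bsub>M\<^esub>"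
      using u by (simp add: hom B M.l_neg c)
    then show "\<exists>y\<in>\<phi> ` B. y \<oplus>\<^bsub>X\<^esub> x = \<phi> \<zero>\<^bsub>M\<^esub>"
      using B(5)[OF u(1)] by (meson imageI)
  qed (auto simp: hom B M.a_comm c)
  then show ?thesis
    apply (intro right_module.intro right_module_axioms.intro R.ring_axioms)
        apply (auto simp: presentsD(4) hom B c smult_one)
      apply (auto simp: hom B c smult_l_distr smult_r_distr smult_assoc)
    done
qed

lemma presents_submodule_image:
  assumes "submodule N R M" "N \<subseteq> B"
  shows "submodule (\<phi> ` N) R X"
proof -
  interpret X: right_module R X by (rule presents_right_module)
  note N = submoduleD[OF assms(1)] and hom = presentsD(6,7)[symmetric]
  have "x \<in> B" if "x \<in> N" for x using that assms(2) by auto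
  then show ?thesis
    unfolding X.submodule_iff by (auto simp: presentsD(4,5) N hom)
qed

text \<open>
  Together with the preceding lemma, this is the correspondence between submodules of \<open>X\<close> and
  submodules of \<open>M\<close> between \<open>A\<close> and \<open>B\<close>.
\<close>

lemma presents_submodule_vimage:
  assumes "submodule C R X"
  obtains N where "submodule N R M" "A \<subseteq> N" "N \<subseteq> B" "N = {x \<in> B. \<phi> x \<in> C}" "C = \<phi> ` N"
proof
  interpret X: right_module R X by (rule presents_right_module)
  note C = X.submoduleD[OF assms] and B = submoduleD[OF presentsD(2)]
  let ?N = "{x \<in> B. \<phi> x \<in> C}"
  show "submodule ?N R M"
    unfolding submodule_iff using B C by (auto simp: presentsD(6,7) presentsD(5)[symmetric])
  show "A \<subseteq> ?N"
  proof
    fix x assume "x \<in> A"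
    then have "x \<in> B" "\<phi> x = \<phi> \<zero>\<^bsub>M\<^esub>" using presentsD(3,8) by blast+
    then show "x \<in> ?N" using C(2) by (simp add: presentsD(5))
  qed
  show "?N \<subseteq> B" by (rule Collect_restrict)
  show "?N = ?N" by (rule refl)
  show "C = \<phi> ` ?N" using C(1) by (auto simp: presentsD(4))
qed

lemma presents_fibre:
  assumes "x \<in> B" "y \<in> B" "\<phi> x = \<phi> y"
  shows "\<exists>k\<in>A. x = k \<oplus>\<^bsub>M\<^esub> y"
proof
  note B = submoduleD[OF presentsD(2)] and hom = presentsD(6,7)
  have c: "x \<in> carrier M" "y \<in> carrier M" using assms B(1) by auto
  have "\<phi> (x \<oplus>\<^bsub>M\<^esub> \<ominus>\<^bsub>M\<^esub> y) = \<phi> y \<oplus>\<^bsub>X\<^esub> \<phi> (\<ominus>\<^bsub>M\<^esub> y)"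
    using assms B by (simp add: hom)
  also have "\<dots> = \<phi> \<zero>\<^bsub>M\<^esub>"
    using assms B c by (simp add: hom[symmetric] M.r_neg)
  finally show "x \<oplus>\<^bsub>M\<^esub> \<ominus>\<^bsub>M\<^esub> y \<in> A"
    using assms B by (simp add: presentsD(8))
  show "x = x \<oplus>\<^bsub>M\<^esub> \<ominus>\<^bsub>M\<^esub> y \<oplus>\<^bsub>M\<^esub> y"
    using c by (simp add: M.a_assoc M.l_neg)
qed

text \<open>
  The third isomorphism theorem.  It works because a coset of \<open>\<phi>(N)\<close> in \<open>\<phi>(N')\<close> is the image of a coset
  of \<open>N\<close> in \<open>N'\<close>; as \<open>N\<close> contains the kernel of \<open>\<phi>\<close>, the latter is determined by its image.  Two cosets
  with a common element coincide, so that the choice of representatives is injective.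
\<close>

lemma presents_quotient:
  assumes N: "submodule N R M" "submodule N' R M" "A \<subseteq> N" "N \<subseteq> N'" "N' \<subseteq> B"
  shows "presents (\<lambda>x. \<phi> ` (N +>\<^bsub>M\<^esub> x)) (quotient_module (X\<lparr>carrier := \<phi> ` N'\<rparr>) (\<phi> ` N)) N N'"
      (is ?presents)
    and "inj_on (\<lambda>Y. SOME y. y \<in> Y) (carrier (quotient_module (X\<lparr>carrier := \<phi> ` N'\<rparr>) (\<phi> ` N)))"
      (is ?inj)
proof -
  note n = submoduleD[OF N(1)] and n' = submoduleD[OF N(2)] and hom = presentsD(6,7)
  have B: "x \<in> B" if "x \<in> N'" for x using that N by auto
  have c: "x \<in> carrier M" if "x \<in> N'" for x using that n'(1) by auto
  interpret N: abelian_subgroup N M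
    by (intro abelian_subgroupI3 additive_subgroup.intro submodule.axioms(1)[OF N(1)]
        abelian_group_axioms)
  have mem: "y \<in> N +>\<^bsub>M\<^esub> x \<longleftrightarrow> (\<exists>k\<in>N. y = k \<oplus>\<^bsub>M\<^esub> x)" for x y
    by (auto simp: a_r_coset_def')
  have sub: "N +>\<^bsub>M\<^esub> x \<subseteq> N'" if "x \<in> N'" for x
    using that n'(3) subsetD[OF N(4)] by (auto simp: mem)
  have self: "x \<in> N +>\<^bsub>M\<^esub> x" if "x \<in> N'" for x
    using that c N.a_rcos_self by blast
  have coset: "\<phi> ` N +>\<^bsub>X\<^esub> \<phi> x = \<phi> ` (N +>\<^bsub>M\<^esub> x)" if "x \<in> N'" for x
  proof -
    have "\<phi> (k \<oplus>\<^bsub>M\<^esub> x) = \<phi> k \<oplus>\<^bsub>X\<^esub> \<phi> x" if "k \<in> N" for k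
      using that \<open>x \<in> N'\<close> N(4) B by (intro hom(1)) auto
    then show ?thesis by (simp add: a_r_coset_def' image_UN cong: SUP_cong_simp)
  qed
  have mem_img: "y \<in> N +>\<^bsub>M\<^esub> x" if xy: "x \<in> N'" "y \<in> N'" "\<phi> y \<in> \<phi> ` (N +>\<^bsub>M\<^esub> x)" for x y
  proof -
    obtain z where z: "z \<in> N +>\<^bsub>M\<^esub> x" "\<phi> y = \<phi> z" using xy(3) by blast
    then have "z \<in> B" using sub[OF xy(1)] B by blast
    then obtain k where k: "k \<in> A" "y = k \<oplus>\<^bsub>M\<^esub> z"
      using presents_fibre[of y z] B[OF xy(2)] z(2) \<open>z \<in> B\<close> by blast
    obtain l where l: "l \<in> N" "z = l \<oplus>\<^bsub>M\<^esub> x" using z(1) by (auto simp: mem)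
    have "y = (k \<oplus>\<^bsub>M\<^esub> l) \<oplus>\<^bsub>M\<^esub> x"
      using k l c[OF xy(1)] subsetD[OF N(3)] n(1) by (simp add: M.a_assoc subsetD)
    moreover have "k \<oplus>\<^bsub>M\<^esub> l \<in> N" using k l n(3) N(3) by blast
    ultimately show ?thesis by (auto simp: mem)
  qed
  have add: "set_add X (\<phi> ` (N +>\<^bsub>M\<^esub> x)) (\<phi> ` (N +>\<^bsub>M\<^esub> y)) = \<phi> ` (N +>\<^bsub>M\<^esub> (x \<oplus>\<^bsub>M\<^esub> y))"
    if xy: "x \<in> N'" "y \<in> N'" for x y
  proof -
    have "set_add X (\<phi> ` (N +>\<^bsub>M\<^esub> x)) (\<phi> ` (N +>\<^bsub>M\<^esub> y)) = \<phi> ` (set_add M (N +>\<^bsub>M\<^esub> x) (N +>\<^bsub>M\<^esub> y))"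
    proof -
      have "\<phi> (u \<oplus>\<^bsub>M\<^esub> v) = \<phi> u \<oplus>\<^bsub>X\<^esub> \<phi> v" if "u \<in> N +>\<^bsub>M\<^esub> x" "v \<in> N +>\<^bsub>M\<^esub> y" for u v
        using that sub[OF xy(1)] sub[OF xy(2)] B by (intro hom(1)) auto
      then show ?thesis by (simp add: set_add_def' image_UN cong: SUP_cong_simp)
    qed
    also have "\<dots> = \<phi> ` (N +>\<^bsub>M\<^esub> (x \<oplus>\<^bsub>M\<^esub> y))"
      using xy c N.a_rcos_sum by simp
    finally show ?thesis .
  qed
  have smult: "(\<Union>z\<in>\<phi> ` (N +>\<^bsub>M\<^esub> x). \<phi> ` N +>\<^bsub>X\<^esub> (a \<odot>\<^bsub>X\<^esub> z)) = \<phi> ` (N +>\<^bsub>M\<^esub> (a \<odot>\<^bsub>M\<^esub> x))"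
    if ax: "a \<in> carrier R" "x \<in> N'" for a x
  proof -
    have "\<phi> ` N +>\<^bsub>X\<^esub> (a \<odot>\<^bsub>X\<^esub> \<phi> y) = \<phi> ` (N +>\<^bsub>M\<^esub> (a \<odot>\<^bsub>M\<^esub> x))" if y: "y \<in> N +>\<^bsub>M\<^esub> x" for y
    proof -
      have y': "y \<in> N'" using y sub ax by blast
      obtain k where k: "k \<in> N" "y = k \<oplus>\<^bsub>M\<^esub> x" using y by (auto simp: mem)
      then have "a \<odot>\<^bsub>M\<^esub> y = a \<odot>\<^bsub>M\<^esub> k \<oplus>\<^bsub>M\<^esub> a \<odot>\<^bsub>M\<^esub> x"
        using ax c N(4) by (simp add: smult_r_distr subsetD)
      then have "a \<odot>\<^bsub>M\<^esub> y \<in> N +>\<^bsub>M\<^esub> (a \<odot>\<^bsub>M\<^esub> x)" using k ax n(4) by (auto simp: mem)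
      then have "N +>\<^bsub>M\<^esub> (a \<odot>\<^bsub>M\<^esub> y) = N +>\<^bsub>M\<^esub> (a \<odot>\<^bsub>M\<^esub> x)"
        using N.a_repr_independence'[of "a \<odot>\<^bsub>M\<^esub> y" "a \<odot>\<^bsub>M\<^esub> x"] ax c n'(4) by simp
      then show ?thesis
        using coset[of "a \<odot>\<^bsub>M\<^esub> y"] hom(2)[OF ax(1) B[OF y']] n'(4)[OF ax(1) y'] by simp
    qed
    then show ?thesis using self[OF ax(2)] by auto
  qed
  have zero: "N +>\<^bsub>M\<^esub> \<zero>\<^bsub>M\<^esub> = N" using n(1) by simp
  have ker: "\<phi> ` (N +>\<^bsub>M\<^esub> x) = \<phi> ` (N +>\<^bsub>M\<^esub> \<zero>\<^bsub>M\<^esub>) \<longleftrightarrow> x \<in> N" if x: "x \<in> N'" for x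
  proof
    assume "\<phi> ` (N +>\<^bsub>M\<^esub> x) = \<phi> ` (N +>\<^bsub>M\<^esub> \<zero>\<^bsub>M\<^esub>)"
    then have "x \<in> N +>\<^bsub>M\<^esub> \<zero>\<^bsub>M\<^esub>" using mem_img[of "\<zero>\<^bsub>M\<^esub>" x] n'(2) x self by blast
    then show "x \<in> N" by (simp add: zero)
  next
    assume "x \<in> N"
    then show "\<phi> ` (N +>\<^bsub>M\<^esub> x) = \<phi> ` (N +>\<^bsub>M\<^esub> \<zero>\<^bsub>M\<^esub>)"
      using N.a_repr_independence'[of x "\<zero>\<^bsub>M\<^esub>"] zero by simp
  qed
  have upd: "H +>\<^bsub>X\<lparr>carrier := K\<rparr>\<^esub> u = H +>\<^bsub>X\<^esub> u"
    "set_add (X\<lparr>carrier := K\<rparr>) = set_add X" for H K u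
    by (simp_all add: a_r_coset_def' set_add_def' fun_eq_iff)
  have car: "a_rcosets\<^bsub>X\<lparr>carrier := \<phi> ` N'\<rparr>\<^esub> (\<phi> ` N) = (\<lambda>x. \<phi> ` (N +>\<^bsub>M\<^esub> x)) ` N'"
    using coset by (simp add: A_RCOSETS_def' upd UNION_singleton_eq_range image_image cong: image_cong_simp)
  have same: "\<phi> ` (N +>\<^bsub>M\<^esub> x) = \<phi> ` (N +>\<^bsub>M\<^esub> y)"
    if xyu: "x \<in> N'" "y \<in> N'" "u \<in> \<phi> ` (N +>\<^bsub>M\<^esub> x)" "u \<in> \<phi> ` (N +>\<^bsub>M\<^esub> y)" for x y u
  proof -
    obtain z where z: "z \<in> N +>\<^bsub>M\<^esub> x" "u = \<phi> z" using xyu(3) by blast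
    then have "z \<in> N'" using sub xyu(1) by blast
    then have "z \<in> N +>\<^bsub>M\<^esub> y" using mem_img[of y z] xyu z by simp
    then show ?thesis
      using N.a_repr_independence'[of z x] N.a_repr_independence'[of z y] z(1) xyu(1,2) c by simp
  qed
  show ?inj
  proof (rule inj_onI)
    fix Y Z
    assume "Y \<in> carrier (quotient_module (X\<lparr>carrier := \<phi> ` N'\<rparr>) (\<phi> ` N))"
      and "Z \<in> carrier (quotient_module (X\<lparr>carrier := \<phi> ` N'\<rparr>) (\<phi> ` N))"
    then obtain x y where xy: "x \<in> N'" "y \<in> N'" "Y = \<phi> ` (N +>\<^bsub>M\<^esub> x)" "Z = \<phi> ` (N +>\<^bsub>M\<^esub> y)"
      unfolding quotient_module_def by (auto simp: car)
    have "Y \<noteq> {}" "Z \<noteq> {}"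
      using self[OF xy(1)] self[OF xy(2)] xy(3,4) by blast+
    then have "(SOME u. u \<in> Y) \<in> Y" "(SOME u. u \<in> Z) \<in> Z"
      by (simp_all only: some_in_eq) simp_all
    moreover assume "(SOME u. u \<in> Y) = (SOME u. u \<in> Z)"
    ultimately have "(SOME u. u \<in> Y) \<in> \<phi> ` (N +>\<^bsub>M\<^esub> x)" "(SOME u. u \<in> Y) \<in> \<phi> ` (N +>\<^bsub>M\<^esub> y)"
      using xy(3,4) by simp_all
    then show "Y = Z" unfolding xy(3,4) by (rule same[OF xy(1,2)])
  qed
  show ?presents
    unfolding presents_def
    using N n'(2) by (simp add: quotient_module_def upd car zero add smult[simplified] ker[unfolded zero])
qed

lemma presents_rename:
  assumes "inj_on f (carrier X)"
  shows "presents (f \<circ> \<phi>) (rename_module f X) A B"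
proof -
  have [simp]: "inv_into (\<phi> ` B) f (f (\<phi> x)) = \<phi> x" if "x \<in> B" for x
    using that assms by (auto intro!: inv_into_f_f simp: presentsD(4))
  have eq: "f (\<phi> x) = f (\<phi> y) \<longleftrightarrow> \<phi> x = \<phi> y" if "x \<in> B" "y \<in> B" for x y
    using that assms by (auto simp: presentsD(4) inj_on_eq_iff)
  show ?thesis
    unfolding presents_def rename_module_def Let_def
    using presentsD submoduleD(2)[OF presentsD(2)] by (simp add: eq image_comp)
qed

end

end

lemma presents_self:
  fixes M :: "('r, 'm) module"
  assumes "right_module R M" "submodule N R M"
  shows "right_module.presents R M id (M\<lparr>carrier := N\<rparr>) {\<zero>\<^bsub>M\<^esub>} N"
proof -
  interpret right_module R M by fact
  show ?thesis using assms(2) submodule_zero submoduleD(2) by (auto simp: presents_def)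
qed

definition factor_module :: "('r, 'm) module \<Rightarrow> 'm set \<Rightarrow> 'm set \<Rightarrow> ('r, 'm) module" where
  "factor_module X C D =
    rename_module (\<lambda>Y. SOME y. y \<in> Y) (quotient_module (X\<lparr>carrier := D\<rparr>) C)"

text \<open>
  The condition that \<open>X\<close> has no smaller dimension disappears when dimensions are only bounded from
  above: for \<open>\<gamma> \<noteq> bot\<close> the chain condition says that \<open>\<gamma>\<close> is the dimension or that a smaller ordinal is.
\<close>

lemma ndim_le_iff:
  fixes \<gamma> :: "'o::{wellorder, order_bot}" and X :: "('r, 'm) module"
  shows "ndim_le R X \<gamma> \<longleftrightarrow> carrier X = {\<zero>\<^bsub>X\<^esub>} \<or>
    (\<gamma> \<noteq> bot \<and> (\<forall>C :: nat \<Rightarrow> 'm set. (\<forall>i. submodule (C i) R X) \<and> (\<forall>i. C i \<subseteq> C (Suc i)) \<longrightarrow>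
      (\<exists>k. \<forall>i\<ge>k. \<exists>\<delta><\<gamma>. ndim_le R (factor_module X (C i) (C (Suc i))) \<delta>)))"
    (is "?l \<longleftrightarrow> carrier X = {\<zero>\<^bsub>X\<^esub>} \<or> (\<gamma> \<noteq> bot \<and> ?chains \<gamma>)")
proof -
  have less: "(\<exists>\<beta>\<in>{..<\<alpha>}. has_ndim R \<beta> Y) \<longleftrightarrow> (\<exists>\<delta><\<alpha>. ndim_le R Y \<delta>)"
    for \<alpha> :: 'o and Y :: "('r, 'm) module"
    unfolding ndim_le_def by (auto intro: le_less_trans)
  have step: "has_ndim R \<alpha> X \<longleftrightarrow>
      (if \<alpha> = bot then carrier X = {\<zero>\<^bsub>X\<^esub>} else \<not> (\<exists>\<delta><\<alpha>. ndim_le R X \<delta>) \<and> ?chains \<alpha>)" for \<alpha> :: 'o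
    by (subst has_ndim.simps) (simp only: less factor_module_def)
  have mono: "?chains \<gamma>" if "?chains \<alpha>" "\<alpha> \<le> \<gamma>" for \<alpha>
  proof (intro allI impI)
    fix C :: "nat \<Rightarrow> 'm set"
    assume "(\<forall>i. submodule (C i) R X) \<and> (\<forall>i. C i \<subseteq> C (Suc i))"
    with that(1) obtain k where "\<forall>i\<ge>k. \<exists>\<delta><\<alpha>. ndim_le R (factor_module X (C i) (C (Suc i))) \<delta>"
      by blast
    then show "\<exists>k. \<forall>i\<ge>k. \<exists>\<delta><\<gamma>. ndim_le R (factor_module X (C i) (C (Suc i))) \<delta>"
      using that(2) order.strict_trans2 by blast
  qed
  show ?thesis
  proof
    assume ?l
    then obtain \<alpha> where a: "\<alpha> \<le> \<gamma>" "has_ndim R \<alpha> X" by (auto simp: ndim_le_def)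
    show "carrier X = {\<zero>\<^bsub>X\<^esub>} \<or> (\<gamma> \<noteq> bot \<and> ?chains \<gamma>)"
    proof (cases "\<alpha> = bot")
      case True
      then show ?thesis using a(2) by (simp add: step)
    next
      case False
      then have "?chains \<alpha>" using a(2) unfolding step by (simp only: if_False) (elim conjE)
      moreover have "\<gamma> \<noteq> bot" using False a(1) bot.extremum_unique by blast
      ultimately show ?thesis using mono a(1) by blast
    qed
  next
    assume "carrier X = {\<zero>\<^bsub>X\<^esub>} \<or> (\<gamma> \<noteq> bot \<and> ?chains \<gamma>)"
    then show ?l
    proof
      assume "carrier X = {\<zero>\<^bsub>X\<^esub>}"
      then have "has_ndim R (bot :: 'o) X" by (simp add: step)
      then show ?l unfolding ndim_le_def using bot.extremum by blast
    next
      assume r: "\<gamma> \<noteq> bot \<and> ?chains \<gamma>"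
      show ?l
      proof (cases "\<exists>\<delta><\<gamma>. ndim_le R X \<delta>")
        case True
        then show ?thesis unfolding ndim_le_def by (meson less_imp_le order_trans)
      next
        case False
        then have "has_ndim R \<gamma> X"
          unfolding step if_not_P[OF conjunct1[OF r]] by (rule conjI[OF _ conjunct2[OF r]])
        then show ?thesis unfolding ndim_le_def by blast
      qed
    qed
  qed
qed

context right_module
begin

text \<open>
  Both sides obey the same recursion, since ascending chains of submodules of \<open>X\<close> correspond to
  ascending chains between \<open>A\<close> and \<open>B\<close>, and the factors of the former are copies of the factors of
  the latter.
\<close>

lemma ndim_le_iff_dev_le:
  fixes \<gamma> :: "'o::{wellorder, order_bot}" and X :: "('r, 'n) module"
  assumes "presents \<phi> X A B"
  shows "ndim_le R X \<gamma> \<longleftrightarrow> dev_le submods \<gamma> A B"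
  using assms
proof (induction \<gamma> arbitrary: \<phi> X A B rule: less_induct)
  case (less \<gamma>)
  note pres = less.prems
  note D = presentsD[OF pres]
  have factor: "ndim_le R (factor_module X (\<phi> ` N) (\<phi> ` N')) \<delta> \<longleftrightarrow> dev_le submods \<delta> N N'"
    if "submodule N R M" "submodule N' R M" "A \<subseteq> N" "N \<subseteq> N'" "N' \<subseteq> B" "\<delta> < \<gamma>" for N N' \<delta>
    unfolding factor_module_def
    by (rule less.IH[OF that(6) presents_rename[OF presents_quotient[OF pres that(1-5)]]])
  have zero: "carrier X = {\<zero>\<^bsub>X\<^esub>} \<longleftrightarrow> A = B"
  proof
    assume "carrier X = {\<zero>\<^bsub>X\<^esub>}"
    then have "\<phi> x = \<phi> \<zero>\<^bsub>M\<^esub>" if "x \<in> B" for x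
      using imageI[OF that, of \<phi>] D(4,5) by simp
    then show "A = B" using D(3,8) by blast
  next
    assume "A = B"
    then have "\<phi> ` B = (\<lambda>_. \<phi> \<zero>\<^bsub>M\<^esub>) ` B" using D(8) by (intro image_cong) blast+
    then show "carrier X = {\<zero>\<^bsub>X\<^esub>}"
      unfolding D(4,5) using submoduleD(2)[OF D(2)] by blast
  qed
  show ?case
  proof
    assume ndim: "ndim_le R X \<gamma>"
    show "dev_le submods \<gamma> A B"
    proof (cases "A = B")
      case True
      then show ?thesis by (simp add: dev_le.trivial)
    next
      case False
      then have "carrier X \<noteq> {\<zero>\<^bsub>X\<^esub>}" by (simp only: zero not_False_eq_True)
      with ndim_le_iff[THEN iffD1, OF ndim]
      have chains: "\<forall>C :: nat \<Rightarrow> 'n set. (\<forall>i. submodule (C i) R X) \<and> (\<forall>i. C i \<subseteq> C (Suc i)) \<longrightarrow>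
          (\<exists>k. \<forall>i\<ge>k. \<exists>\<delta><\<gamma>. ndim_le R (factor_module X (C i) (C (Suc i))) \<delta>)"
        by (elim disjE) (erule (1) notE, erule conjunct2)
      show ?thesis
      proof (rule dev_le.chain)
        fix N :: "nat \<Rightarrow> 'm set"
        assume "\<And>i. N i \<in> submods \<and> A \<subseteq> N i \<and> N i \<subseteq> B \<and> N i \<subseteq> N (Suc i)"
        then have N: "submodule (N i) R M" "A \<subseteq> N i" "N i \<subseteq> B" "N i \<subseteq> N (Suc i)" for i
          by auto
        have "\<exists>k. \<forall>i\<ge>k. \<exists>\<delta><\<gamma>. ndim_le R (factor_module X (\<phi> ` N i) (\<phi> ` N (Suc i))) \<delta>"
          by (intro chains[THEN spec, of "\<lambda>i. \<phi> ` N i", THEN mp] conjI allI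
              presents_submodule_image[OF pres N(1,3)] image_mono N(4))
        then show "\<exists>k. \<forall>i\<ge>k. \<exists>\<delta><\<gamma>. dev_le submods \<delta> (N i) (N (Suc i))"
          using factor[OF N(1,1,2,4,3)] by blast
      qed
    qed
  next
    assume dev: "dev_le submods \<gamma> A B"
    show "ndim_le R X \<gamma>"
    proof (cases "A = B")
      case True
      then show ?thesis by (subst ndim_le_iff) (simp add: zero)
    next
      case False
      then obtain \<delta>' where d': "\<delta>' < \<gamma>"
        using dev_le_exists_less[OF dev, of A] D(1,3) by blast
      have "\<exists>k. \<forall>i\<ge>k. \<exists>\<delta><\<gamma>. ndim_le R (factor_module X (C i) (C (Suc i))) \<delta>"
        if C: "(\<forall>i. submodule (C i) R X) \<and> (\<forall>i. C i \<subseteq> C (Suc i))" for C :: "nat \<Rightarrow> 'n set"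
      proof -
        define N where "N i = {x \<in> B. \<phi> x \<in> C i}" for i
        have N: "submodule (N i) R M" "A \<subseteq> N i" "N i \<subseteq> B" "C i = \<phi> ` N i" for i
          using presents_submodule_vimage[OF pres, of "C i"] C unfolding N_def by metis+
        have mono: "N i \<subseteq> N (Suc i)" for i using C by (auto simp: N_def)
        have "\<exists>k. \<forall>i\<ge>k. \<exists>\<delta><\<gamma>. dev_le submods \<delta> (N i) (N (Suc i))"
          using N mono by (intro dev_le_chain[OF dev d']) auto
        then show ?thesis
          unfolding N(4) using factor[OF N(1,1,2) mono N(3)] by blast
      qed
      moreover have "\<gamma> \<noteq> bot" using d' by auto
      ultimately show ?thesis by (subst ndim_le_iff) blast
    qed
  qed
qed

end

lemma ndim_le_submodule_iff:
  fixes M :: "('r, 'm) module"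
  assumes "right_module R M" "submodule N R M"
  shows "ndim_le R (M\<lparr>carrier := N\<rparr>) \<gamma> \<longleftrightarrow> dev_le {N. submodule N R M} \<gamma> {\<zero>\<^bsub>M\<^esub>} N"
  by (rule right_module.ndim_le_iff_dev_le[OF assms(1) presents_self[OF assms]])

lemma ndim_le_quotient_iff:
  fixes M :: "('r, 'm) module"
  assumes "right_module R M" "submodule N R M"
  shows "ndim_le R (quotient_module M N) \<gamma> \<longleftrightarrow> dev_le {N. submodule N R M} \<gamma> N (carrier M)"
proof -
  interpret right_module R M by fact
  note self = presents_self[OF assms(1) submodule_carrier]
  show ?thesis
    using ndim_le_iff_dev_le[OF presents_quotient(1)[OF self assms(2) submodule_carrier]]
      submoduleD(1,2)[OF assms(2)]
    by simp
qed

section \<open>Short modules\<close>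

context right_module
begin

text \<open>
  The maps \<open>P \<mapsto> P + N\<close> and \<open>P \<mapsto> P \<inter> N + K\<close> send the submodules above \<open>N \<inter> K\<close> to those above \<open>N\<close> and
  \<open>K\<close>.  They separate comparable submodules: the second one determines \<open>P \<inter> N\<close>, which together with
  \<open>P + N\<close> determines \<open>P\<close> by the modular law.  In terms of modules, \<open>M/(N \<inter> K)\<close> embeds into
  \<open>M/N \<oplus> M/K\<close>.
\<close>

lemma dev_le_Int:
  assumes "submodule N R M" "submodule K R M"
    and "dev_le submods \<gamma> N (carrier M)" "dev_le submods \<gamma> K (carrier M)"
  shows "dev_le submods \<gamma> (N \<inter> K) (carrier M)"
proof (rule dev_le_jointly_strict[OF assms(3,4), where g = "\<lambda>P. P <+>\<^bsub>M\<^esub> N"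
      and h = "\<lambda>P. (P \<inter> N) <+>\<^bsub>M\<^esub> K"])
  show "N \<inter> K \<subseteq> carrier M" using submoduleD(1)[OF assms(1)] by blast
  show "N \<inter> K \<in> submods" "carrier M \<in> submods"
    using assms(1,2) submodule_Int submodule_carrier by simp_all
next
  fix P assume "P \<in> submods"
  then have P: "submodule P R M" by simp
  show "P <+>\<^bsub>M\<^esub> N \<in> submods \<and> N \<subseteq> P <+>\<^bsub>M\<^esub> N \<and> P <+>\<^bsub>M\<^esub> N \<subseteq> carrier M"
    using submodule_sum[OF P assms(1)] sum_upper[OF P assms(1)] submoduleD(1) by blast
  have PN: "submodule (P \<inter> N) R M" using P assms(1) by (rule submodule_Int)
  show "(P \<inter> N) <+>\<^bsub>M\<^esub> K \<in> submods \<and> K \<subseteq> (P \<inter> N) <+>\<^bsub>M\<^esub> K \<and> (P \<inter> N) <+>\<^bsub>M\<^esub> K \<subseteq> carrier M"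
    using submodule_sum[OF PN assms(2)] sum_upper[OF PN assms(2)] submoduleD(1) by blast
next
  fix P Q assume PQ: "P \<in> submods" "Q \<in> submods" "N \<inter> K \<subseteq> P" "P \<subseteq> Q"
  show "P <+>\<^bsub>M\<^esub> N \<subseteq> Q <+>\<^bsub>M\<^esub> N" "(P \<inter> N) <+>\<^bsub>M\<^esub> K \<subseteq> (Q \<inter> N) <+>\<^bsub>M\<^esub> K"
    using PQ(4) by (blast intro!: sum_mono)+
  assume eq: "P <+>\<^bsub>M\<^esub> N = Q <+>\<^bsub>M\<^esub> N" "(P \<inter> N) <+>\<^bsub>M\<^esub> K = (Q \<inter> N) <+>\<^bsub>M\<^esub> K"
  have "P \<inter> N = Q \<inter> N"
    by (rule eq_if_sum_eq[OF _ _ assms(2) _ eq(2)]) (use PQ assms(1) submodule_Int in auto)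
  then show "P = Q"
    by (intro eq_if_sum_eq[OF _ _ assms(1) _ eq(1)]) (use PQ in auto)
qed

text \<open>
  If adding \<open>D\<close> collapses nothing between \<open>C\<close> and \<open>C'\<close>, then \<open>C'/C\<close> is isomorphic to
  \<open>(C' + D)/(C + D)\<close>.
\<close>

lemma dev_le_sum_cancel:
  assumes "submodule C R M" "submodule C' R M" "submodule D R M" "C \<subseteq> C'" "C' \<inter> D \<subseteq> C"
    and "dev_le submods \<gamma> (C <+>\<^bsub>M\<^esub> D) (C' <+>\<^bsub>M\<^esub> D)"
  shows "dev_le submods \<gamma> C C'"
proof (rule dev_le_strict[OF assms(6), where g = "\<lambda>P. P <+>\<^bsub>M\<^esub> D"])
  fix P Q assume PQ: "P \<in> submods" "Q \<in> submods" "C \<subseteq> P" "P \<subseteq> Q" "Q \<subseteq> C'"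
    "P <+>\<^bsub>M\<^esub> D = Q <+>\<^bsub>M\<^esub> D"
  show "P = Q"
    by (rule eq_if_sum_eq[OF _ _ assms(3) PQ(4,6)]) (use PQ assms(5) in auto)
next
  fix P assume "P \<in> submods" "C \<subseteq> P" "P \<subseteq> C'"
  then show "P <+>\<^bsub>M\<^esub> D \<in> submods \<and> C <+>\<^bsub>M\<^esub> D \<subseteq> P <+>\<^bsub>M\<^esub> D \<and> P <+>\<^bsub>M\<^esub> D \<subseteq> C' <+>\<^bsub>M\<^esub> D"
    using submodule_sum[OF _ assms(3)] sum_mono by simp
next
  fix P Q :: "'m set" assume "P \<subseteq> Q"
  then show "P <+>\<^bsub>M\<^esub> D \<subseteq> Q <+>\<^bsub>M\<^esub> D" by (rule sum_mono)
qed (use assms(1,2,4) in simp_all)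

text \<open>
  Let \<open>F S\<close> be the intersection of all \<open>E k\<close> with \<open>k \<notin> S\<close>.  It contains \<open>x k\<close> exactly for \<open>k \<in> S\<close>, so
  \<open>F\<close> is strictly monotone.  With \<open>N\<close> the value of \<open>F\<close> at the even numbers, the sets of even numbers
  give a copy of the power set below \<open>N\<close>, and the sets containing all even numbers give one above.
\<close>

lemma not_short_if_independent:
  fixes E :: "nat \<Rightarrow> 'm set" and \<gamma> :: "'o::wellorder"
  assumes E: "\<And>k. submodule (E k) R M" and x: "\<And>k. x k \<in> carrier M"
    and notin: "\<And>k. x k \<notin> E k" and mem: "\<And>k l. k \<noteq> l \<Longrightarrow> x k \<in> E l"
  obtains N where "submodule N R M" "\<not> dev_le submods \<gamma> {\<zero>\<^bsub>M\<^esub>} N"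
    "\<not> dev_le submods \<gamma> N (carrier M)"
proof
  (* The carrier is included so that the intersection stays inside the module when S = UNIV. *)
  define F where "F S = \<Inter>(insert (carrier M) (E ` (- S)))" for S
  have sub: "submodule (F S) R M" for S
    unfolding F_def using E submodule_carrier by (intro submodule_Inter) auto
  have mono: "F S \<subseteq> F S'" if "S \<subseteq> S'" for S S' using that by (auto simp: F_def)
  have strict: "F S \<subset> F S'" if "S \<subset> S'" for S S'
  proof -
    obtain k where "k \<in> S'" "k \<notin> S" using \<open>S \<subset> S'\<close> by blast
    moreover from this have "x k \<in> E l" if "l \<notin> S'" for l using mem that by metis
    ultimately have "x k \<in> F S'" "x k \<notin> F S" using x notin[of k] by (auto simp: F_def)
    then show ?thesis using mono that by blast
  qed
  let ?N = "F (range (\<lambda>n. 2 * n))"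
  show "submodule ?N R M" by (rule sub)
  show "\<not> dev_le submods \<gamma> {\<zero>\<^bsub>M\<^esub>} ?N"
  proof (rule no_dev_le_powerset)
    fix S :: "nat set"
    show "F ((\<lambda>n. 2 * n) ` S) \<in> submods \<and> {\<zero>\<^bsub>M\<^esub>} \<subseteq> F ((\<lambda>n. 2 * n) ` S) \<and> F ((\<lambda>n. 2 * n) ` S) \<subseteq> ?N"
      using sub submoduleD(2)[OF sub] mono[OF image_mono[OF subset_UNIV]] by simp
  next
    fix S S' :: "nat set" assume "S \<subset> S'"
    then have "(\<lambda>n. 2 * n) ` S \<subset> (\<lambda>n. 2 * n :: nat) ` S'"
      by (intro image_strict_mono) (auto intro: inj_onI)
    then show "F ((\<lambda>n. 2 * n) ` S) \<subset> F ((\<lambda>n. 2 * n) ` S')" by (rule strict)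
  qed
  show "\<not> dev_le submods \<gamma> ?N (carrier M)"
  proof (rule no_dev_le_powerset)
    fix S :: "nat set"
    let ?S = "range (\<lambda>n. 2 * n) \<union> (\<lambda>n. 2 * n + 1) ` S"
    have "F ?S \<subseteq> carrier M" by (rule submoduleD(1)) (rule sub)
    then show "F ?S \<in> submods \<and> ?N \<subseteq> F ?S \<and> F ?S \<subseteq> carrier M"
      using sub mono[of "range (\<lambda>n. 2 * n)" ?S] by simp
  next
    fix S S' :: "nat set" assume "S \<subset> S'"
    then obtain n where n: "n \<in> S'" "n \<notin> S" "S \<subseteq> S'" by blast
    then have "2 * n + 1 \<notin> range (\<lambda>n. 2 * n) \<union> (\<lambda>n. 2 * n + 1) ` S"
      by (auto simp: image_iff; presburger)
    with n have "range (\<lambda>n. 2 * n) \<union> (\<lambda>n. 2 * n + 1) ` S \<subset> range (\<lambda>n. 2 * n) \<union> (\<lambda>n. 2 * n + 1) ` S'"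
      by blast
    then show "F (range (\<lambda>n. 2 * n) \<union> (\<lambda>n. 2 * n + 1) ` S) \<subset> F (range (\<lambda>n. 2 * n) \<union> (\<lambda>n. 2 * n + 1) ` S')"
      by (rule strict)
  qed
qed

end

text \<open>
  The system \<open>\<T>\<close> of cosmall submodules has a cosmall intersection.  Without the assumption that every
  submodule is small or cosmall this fails, even for \<open>\<beta> = 0\<close>, in the abelian group that is the direct
  sum of \<open>\<int>/p\<int>\<close> over all primes \<open>p\<close>.  Its lattice of submodules is the power set of the set of primes,
  so it is AB5*; its subgroups with finite quotient intersect in zero, but it is not Noetherian.
\<close>

lemma dev_le_Inter_if_short:
  fixes R :: "('r, 'z) ring_scheme" and M :: "('r, 'm) module" and \<beta> :: "'o::wellorder"
  defines "L \<equiv> {N. submodule N R M}"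
  defines "\<T> \<equiv> {N \<in> L. dev_le L \<beta> N (carrier M)}"
  assumes "right_module R M" "AB5_star R M"
    and short: "\<And>N. N \<in> L \<Longrightarrow> dev_le L \<beta> {\<zero>\<^bsub>M\<^esub>} N \<or> dev_le L \<beta> N (carrier M)"
  shows "dev_le L \<beta> (\<Inter>\<T>) (carrier M)"
proof (rule ccontr)
  interpret right_module R M by fact
  assume not_dev: "\<not> dev_le L \<beta> (\<Inter>\<T>) (carrier M)"
  have T: "submodule D R M" "dev_le L \<beta> D (carrier M)" if "D \<in> \<T>" for D
    using that by (auto simp: \<T>_def L_def)
  have carrier: "carrier M \<in> \<T>"
    by (simp add: \<T>_def L_def submodule_carrier dev_le.trivial)
  have Int: "D \<inter> D' \<in> \<T>" if "D \<in> \<T>" "D' \<in> \<T>" for D D'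
    using that submodule_Int dev_le_Int by (auto simp: \<T>_def L_def)
  have "\<Inter>\<T> \<noteq> carrier M" using not_dev dev_le.trivial by metis
  then obtain D0 where D0: "D0 \<in> \<T>" "D0 \<noteq> carrier M" using carrier by blast
  then obtain \<delta>' where d': "\<delta>' < \<beta>"
    using dev_le_exists_less[OF T(2)[OF D0(1)] D0(2), of D0] T(1)[OF D0(1)] submoduleD(1)
    by (auto simp: L_def)
  obtain C :: "nat \<Rightarrow> 'm set" where C': "\<And>i. C i \<in> L \<and> \<Inter>\<T> \<subseteq> C i \<and> C i \<subseteq> carrier M \<and> C i \<subseteq> C (Suc i)"
    and big: "\<not> (\<exists>k. \<forall>i\<ge>k. \<exists>\<delta><\<beta>. dev_le L \<delta> (C i) (C (Suc i)))"
    using not_dev dev_le.chain[of L "\<Inter>\<T>" "carrier M" \<beta>] by blast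
  from C' have C: "submodule (C i) R M" "\<Inter>\<T> \<subseteq> C i" "C i \<subseteq> C (Suc i)" for i
    by (auto simp: L_def)
  have C_mono: "C i \<subseteq> C j" if "i \<le> j" for i j
    using C(3) that by (rule lift_Suc_mono_le)
  have AB5: "C i <+>\<^bsub>M\<^esub> \<Inter>\<T> = (\<Inter>D\<in>\<T>. C i <+>\<^bsub>M\<^esub> D)" for i
  proof -
    have "\<exists>D''\<in>\<T>. D'' \<subseteq> D \<and> D'' \<subseteq> D'" if "D \<in> \<T>" "D' \<in> \<T>" for D D'
      using Int[OF that] by (intro bexI[of _ "D \<inter> D'"]) simp_all
    moreover have "\<T> \<noteq> {}" using carrier by (metis empty_iff)
    ultimately have "submodule (C i) R M \<and> \<T> \<noteq> {} \<and> (\<forall>D\<in>\<T>. submodule D R M) \<and>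
        (\<forall>D\<in>\<T>. \<forall>D'\<in>\<T>. \<exists>D''\<in>\<T>. D'' \<subseteq> D \<and> D'' \<subseteq> D')"
      using C(1) T(1) by (intro conjI ballI)
    then have "C i <+>\<^bsub>M\<^esub> (\<Inter>D\<in>\<T>. D) = (\<Inter>D\<in>\<T>. C i <+>\<^bsub>M\<^esub> D)"
      by (rule assms(4)[unfolded AB5_star_def, THEN spec, THEN spec, THEN mp])
    then show ?thesis by (simp only: image_ident)
  qed
  (* D is cosmall, so the chain C i + D has no big steps from k on, while C has one at some j \<ge> k;
     there D must contribute a new element x, and AB5* separates x from C j by a smaller D'. *)
  have step: "\<exists>j x D'. m \<le> j \<and> D' \<in> \<T> \<and> D' \<subseteq> D \<and> x \<in> C (Suc j) \<inter> D \<and> x \<notin> C j <+>\<^bsub>M\<^esub> D'"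
    if D: "D \<in> \<T>" for D m
  proof -
    have "\<exists>k. \<forall>i\<ge>k. \<exists>\<delta><\<beta>. dev_le L \<delta> (C i <+>\<^bsub>M\<^esub> D) (C (Suc i) <+>\<^bsub>M\<^esub> D)"
    proof (rule dev_le_chain[OF T(2)[OF D] d'])
      fix i
      show "C i <+>\<^bsub>M\<^esub> D \<in> L \<and> D \<subseteq> C i <+>\<^bsub>M\<^esub> D \<and> C i <+>\<^bsub>M\<^esub> D \<subseteq> carrier M"
        using submodule_sum[OF C(1) T(1)[OF D]] sum_upper[OF C(1) T(1)[OF D]] submoduleD(1)
        unfolding L_def by blast
      show "C i <+>\<^bsub>M\<^esub> D \<subseteq> C (Suc i) <+>\<^bsub>M\<^esub> D" using C(3) by (rule sum_mono)
    qed
    then obtain k where k: "\<And>i. i \<ge> k \<Longrightarrow> \<exists>\<delta><\<beta>. dev_le L \<delta> (C i <+>\<^bsub>M\<^esub> D) (C (Suc i) <+>\<^bsub>M\<^esub> D)"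
      by blast
    obtain j where j: "j \<ge> max m k" "\<not> (\<exists>\<delta><\<beta>. dev_le L \<delta> (C j) (C (Suc j)))"
      using big by blast
    obtain \<delta> where d: "\<delta> < \<beta>" "dev_le L \<delta> (C j <+>\<^bsub>M\<^esub> D) (C (Suc j) <+>\<^bsub>M\<^esub> D)"
      using k[of j] j(1) by auto
    have "\<not> C (Suc j) \<inter> D \<subseteq> C j"
      using dev_le_sum_cancel[OF C(1) C(1) T(1)[OF D] C(3)] d j(2) unfolding L_def by blast
    then obtain x where x: "x \<in> C (Suc j) \<inter> D" "x \<notin> C j" by blast
    have "C j <+>\<^bsub>M\<^esub> \<Inter>\<T> \<subseteq> C j" using C(1,2) by (intro sum_least) auto
    then obtain D1 where D1: "D1 \<in> \<T>" "x \<notin> C j <+>\<^bsub>M\<^esub> D1"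
      using x(2) AB5[of j] by blast
    have "x \<notin> C j <+>\<^bsub>M\<^esub> (D \<inter> D1)" using D1(2) by (auto simp: mem_sum_iff)
    moreover have "m \<le> j" using j(1) by simp
    ultimately show ?thesis using Int[OF D D1(1)] x(1) by blast
  qed
  (* A state (D, j, x, D') records one such choice; the next one starts from D' and beyond j. *)
  define P where "P s \<longleftrightarrow> (case s of (D, j, x, D') \<Rightarrow>
    D \<in> \<T> \<and> D' \<in> \<T> \<and> D' \<subseteq> D \<and> x \<in> C (Suc j) \<inter> D \<and> x \<notin> C j <+>\<^bsub>M\<^esub> D')"
    for s :: "'m set \<times> nat \<times> 'm \<times> 'm set"
  define Q where "Q s t \<longleftrightarrow> fst t = snd (snd (snd s)) \<and> Suc (fst (snd s)) \<le> fst (snd t)"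
    for s t :: "'m set \<times> nat \<times> 'm \<times> 'm set"
  have "\<exists>f. \<forall>n. P (f n) \<and> Q (f n) (f (Suc n))"
  proof (rule dependent_nat_choice)
    obtain j x D' where "P (carrier M, j, x, D')"
      using step[OF carrier] carrier unfolding P_def prod.case by blast
    then show "\<exists>s. P s" by blast
  next
    fix s :: "'m set \<times> nat \<times> 'm \<times> 'm set"
    assume s: "P s"
    obtain D j x D' where s_eq: "s = (D, j, x, D')" by (cases s)
    then have "D' \<in> \<T>" using s by (simp add: P_def)
    then obtain j' x' D'' where "Suc j \<le> j'" "P (D', j', x', D'')"
      using step[of D' "Suc j"] unfolding P_def prod.case by blast
    then have "P (D', j', x', D'') \<and> Q s (D', j', x', D'')" by (simp add: Q_def s_eq)
    then show "\<exists>t. P t \<and> Q s t" by blast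
  qed
  then obtain f where f: "\<And>n. P (f n)" "\<And>n. Q (f n) (f (Suc n))" by blast
  define D where "D n = fst (f n)" for n
  define j where "j n = fst (snd (f n))" for n
  define x where "x n = fst (snd (snd (f n)))" for n
  have D': "snd (snd (snd (f n))) = D (Suc n)" for n using f(2)[of n] by (simp add: Q_def D_def)
  have s: "D n \<in> \<T>" "D (Suc n) \<subseteq> D n" "x n \<in> C (Suc (j n))" "x n \<in> D n"
    "x n \<notin> C (j n) <+>\<^bsub>M\<^esub> D (Suc n)" for n
    using f(1)[of n] D'[of n] by (auto simp: P_def D_def j_def x_def split: prod.splits)
  have j_Suc: "Suc (j n) \<le> j (Suc n)" for n using f(2)[of n] by (simp add: Q_def j_def)
  have D_anti: "D m \<subseteq> D n" if "n \<le> m" for m n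
    using s(2) that by (rule lift_Suc_antimono_le)
  have j_less: "Suc (j n) \<le> j m" if "n < m" for m n
  proof -
    have "j (Suc n) \<le> j m"
      by (rule lift_Suc_mono_le[of j, OF Suc_leD[OF j_Suc]]) (use that in simp)
    then show ?thesis using j_Suc[of n] by simp
  qed
  have E_sub: "submodule (C (j k) <+>\<^bsub>M\<^esub> D (Suc k)) R M" for k
    using C(1) T(1)[OF s(1)] by (rule submodule_sum)
  have x_mem: "x k \<in> carrier M" for k using s(3) submoduleD(1)[OF C(1)] by blast
  (* For k < l the element x k is already in the chain at stage j l; for l < k it lies in D k, which
     is contained in D (Suc l). *)
  have x_E: "x k \<in> C (j l) <+>\<^bsub>M\<^esub> D (Suc l)" if "k \<noteq> l" for k l
  proof -
    note upper = sum_upper[OF C(1)[of "j l"] T(1)[OF s(1)[of "Suc l"]]]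
    from \<open>k \<noteq> l\<close> consider "k < l" | "l < k" by linarith
    then show "x k \<in> C (j l) <+>\<^bsub>M\<^esub> D (Suc l)"
    proof cases
      case 1
      then show ?thesis using s(3)[of k] C_mono[OF j_less] upper(1) by blast
    next
      case 2
      then show ?thesis using s(4)[of k] D_anti[of "Suc l" k] upper(2) by auto
    qed
  qed
  obtain N where "submodule N R M" "\<not> dev_le L \<beta> {\<zero>\<^bsub>M\<^esub>} N" "\<not> dev_le L \<beta> N (carrier M)"
    unfolding L_def by (rule not_short_if_independent[where \<gamma> = \<beta>, OF E_sub x_mem s(5) x_E])
  then show False using short by (auto simp: L_def)
qed

theorem theorem3p9:
  fixes R :: "('r, 'z) ring_scheme"
    and M :: "('r, 'm) module"
    and \<alpha> :: "'o::{wellorder, order_bot}"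
  assumes "right_module R M"
    and "AB5_star R M"
  shows "short_module R M \<alpha> \<longleftrightarrow>
    least_ordinal_such_that
      (\<lambda>\<beta>. \<exists>A. submodule A R M \<and> ndim_le R (quotient_module M A) \<beta> \<and>
        (\<forall>N. submodule N R M \<and> \<not> A \<subseteq> N \<longrightarrow> ndim_le R (M\<lparr>carrier := N\<rparr>) \<beta>)) \<alpha>"
proof -
  interpret right_module R M by fact
  note sub_iff = ndim_le_submodule_iff[OF assms(1)] and quot_iff = ndim_le_quotient_iff[OF assms(1)]
  have "(\<forall>N. submodule N R M \<longrightarrow>
        ndim_le R (M\<lparr>carrier := N\<rparr>) \<beta> \<or> ndim_le R (quotient_module M N) \<beta>) \<longleftrightarrow>
      (\<exists>A. submodule A R M \<and> ndim_le R (quotient_module M A) \<beta> \<and>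
        (\<forall>N. submodule N R M \<and> \<not> A \<subseteq> N \<longrightarrow> ndim_le R (M\<lparr>carrier := N\<rparr>) \<beta>))"
    (is "?short \<longleftrightarrow> ?critical") for \<beta> :: 'o
  proof
    assume short: ?short
    let ?T = "{N \<in> submods. dev_le submods \<beta> N (carrier M)}"
    have "carrier M \<in> ?T" by (simp add: submodule_carrier dev_le.trivial)
    then have A: "submodule (\<Inter>?T) R M" by (intro submodule_Inter) auto
    have "dev_le submods \<beta> (\<Inter>?T) (carrier M)"
    proof (rule dev_le_Inter_if_short[OF assms])
      fix N assume "N \<in> submods"
      then have N: "submodule N R M" by simp
      show "dev_le submods \<beta> {\<zero>\<^bsub>M\<^esub>} N \<or> dev_le submods \<beta> N (carrier M)"
        using short[rule_format, OF N] unfolding sub_iff[OF N] quot_iff[OF N] .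
    qed
    then have "ndim_le R (quotient_module M (\<Inter>?T)) \<beta>" by (rule quot_iff[OF A, THEN iffD2])
    moreover have "ndim_le R (M\<lparr>carrier := N\<rparr>) \<beta>" if N: "submodule N R M" "\<not> \<Inter>?T \<subseteq> N" for N
    proof -
      have "\<not> dev_le submods \<beta> N (carrier M)" using N by blast
      then show ?thesis using short[rule_format, OF N(1)] unfolding quot_iff[OF N(1)] by simp
    qed
    ultimately show ?critical using A by blast
  next
    assume ?critical
    then obtain A where A: "submodule A R M" "ndim_le R (quotient_module M A) \<beta>"
      "\<And>N. submodule N R M \<Longrightarrow> \<not> A \<subseteq> N \<Longrightarrow> ndim_le R (M\<lparr>carrier := N\<rparr>) \<beta>"
      by blast
    have "ndim_le R (quotient_module M N) \<beta>" if N: "submodule N R M" "A \<subseteq> N" for N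
    proof -
      have "dev_le submods \<beta> A (carrier M)" using A(2) unfolding quot_iff[OF A(1)] .
      then have "dev_le submods \<beta> N (carrier M)"
        using N submodule_carrier submoduleD(1)[OF N(1)] by (auto elim: dev_le_subinterval)
      then show ?thesis unfolding quot_iff[OF N(1)] .
    qed
    then show ?short using A(3) by blast
  qed
  then show ?thesis by (simp add: short_module_def)
qed

end
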